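(* Let $(G,\mathcal{T})$ be a separable topological group metrized by a right-invariant metric $d$, and write $\|t\|:=d(1_G,t)$. Let $\mathcal{D}_{\mathcal{B}}(\mathcal{T})$ be the family of all subsets of $G$ that are $\mathcal{T}$-locally comeagre at all of their points. Then $\mathcal{D}_{\mathcal{B}}(\mathcal{T})$ is a topology on $G$ and: (i) $t\,\mathcal{D}_{\mathcal{B}}(\mathcal{T})\subseteq\mathcal{D}_{\mathcal{B}}(\mathcal{T})$ for all $t\in G$, and $\mathcal{T}\subseteq\mathcal{D}_{\mathcal{B}}(\mathcal{T})$; (ii) $\mathcal{D}_{\mathcal{B}}(\mathcal{T})\subseteq\mathcal{B}(\mathcal{T})$; (iii) $H\setminus\mathrm{int}_{\mathcal{D}_{\mathcal{B}}(\mathcal{T})}(H)\in\mathcal{B}_0(\mathcal{T})$ for every $H\in\mathcal{B}(\mathcal{T})$; in fact, if $S\in\mathcal{B}(\mathcal{T})$, then $S$ has non-empty $\mathcal{D}_{\mathcal{B}}(\mathcal{T})$-interior in each (non-empty $\mathcal{T}$-open) neighbourhood on which it is dense and non-meagre; (iv) (Kemperman property) for every $H\in\mathcal{D}_{\mathcal{B}}(\mathcal{T})$ with $1_G\in H$ there is $\delta>0$ such that $H\cap(tH)\in\mathcal{B}_+(\mathcal{D}_{\mathcal{B}}(\mathcal{T}))$ for all $t\in G$ with $\|t\|<\delta$; (v) $\mathcal{D}_{\mathcal{B}}(\mathcal{T})$ is a strong generalized Gandy-Harrington topology: modulo $\mathcal{B}_0(\mathcal{D}_{\mathcal{B}}(\mathcal{T}))$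 each set in $\mathcal{B}(\mathcal{D}_{\mathcal{B}}(\mathcal{T}))$ is analytic under $\mathcal{T}$; and in fact $\mathcal{D}_{\mathcal{B}}(\mathcal{T})\cap\mathcal{G}_\delta(\mathcal{T})$ is a weak $\mathcal{D}_{\mathcal{B}}(\mathcal{T})$-base, so $(G,\mathcal{D}_{\mathcal{B}}(\mathcal{T}))$ is a Baire space.
   Context: For a topology $\tau$ on $G$: $\mathcal{B}(\tau)$ is the family of sets with the Baire property in $\tau$, $\mathcal{B}_0(\tau)$ the $\tau$-meagre sets, $\mathcal{B}_+(\tau):=\mathcal{B}(\tau)\setminus\mathcal{B}_0(\tau)$, $\mathcal{G}_\delta(\tau)$ the $G_\delta$ sets of $\tau$, and $\mathrm{int}_\tau$ the $\tau$-interior. A set $H$ is $\tau$-locally comeagre at all of its points if for each $x\in H$ there is a $\tau$-open neighbourhood $U$ of $x$ such that $U\setminus H$ is $\tau$-meagre. A weak $\tau$-base is a subfamily $\mathcal{W}\subseteq\tau$ such that each non-empty $V\in\tau$ contains a non-empty $W\in\mathcal{W}$. A set is analytic under $\mathcal{T}$ if it has the form $K(I)=\bigcup_{i\in I}K(i)$, where $I=\omega^\omega$ and $K$ is an upper-semicontinuous compact-valued map from $I$ to the subsets of $(G,\mathcal{T})$ (here, $\mathcal{T}$ being metrizable, this amounts to being empty or a continuous image of $\omega^\omega$). "Modulo $\mathcal{B}_0(\tau)$ a set $A$ is analytic under $\mathcal{T}$" means that $A$ agrees, up to a set in $\mathcal{B}_0(\tau)$, with a set analytic under $\mathcal{T}$.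 For $t\in G$, $t\,\mathcal{D}:=\{tV:V\in\mathcal{D}\}$.
   Formalization: The Kemperman property (iv) is asserted only when G is not T-meagre, and the first part of (v) (Baire sets analytic modulo meagre sets) only when G is not T-meagre and is analytic under T; both are false for general separable G. *)

theory Defs
  imports "HOL-Analysis.Analysis" "HOL-Algebra.Coset"
begin

definition topological_group_on :: "('a, 'b) monoid_scheme \<Rightarrow> 'a topology \<Rightarrow> bool" where
  "topological_group_on G T \<longleftrightarrow>
     group G \<and> topspace T = carrier G \<and>
     continuous_map (prod_topology T T) T (\<lambda>(x, y). x \<otimes>\<^bsub>G\<^esub> y) \<and>
     continuous_map T T (\<lambda>x. inv\<^bsub>G\<^esub> x)"

definition right_invariant :: "('a, 'b) monoid_scheme \<Rightarrow> ('a \<Rightarrow> 'a \<Rightarrow> real) \<Rightarrow> bool" where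
  "right_invariant G d \<longleftrightarrow>
     (\<forall>x\<in>carrier G. \<forall>y\<in>carrier G. \<forall>g\<in>carrier G.
        d (x \<otimes>\<^bsub>G\<^esub> g) (y \<otimes>\<^bsub>G\<^esub> g) = d x y)"

definition nowhere_dense_in :: "'a topology \<Rightarrow> 'a set \<Rightarrow> bool" where
  "nowhere_dense_in X S \<longleftrightarrow>
     S \<subseteq> topspace X \<and> X interior_of (X closure_of S) = {}"

definition meagre_in :: "'a topology \<Rightarrow> 'a set \<Rightarrow> bool" where
  "meagre_in X S \<longleftrightarrow>
     (\<exists>\<N>. countable \<N> \<and> (\<forall>N\<in>\<N>. nowhere_dense_in X N) \<and> S = \<Union>\<N>)"

definition baire_property_in :: "'a topology \<Rightarrow> 'a set \<Rightarrow> bool" where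
  "baire_property_in X S \<longleftrightarrow>
     S \<subseteq> topspace X \<and> (\<exists>U. openin X U \<and> meagre_in X ((S - U) \<union> (U - S)))"

definition baire_space :: "'a topology \<Rightarrow> bool" where
  "baire_space X \<longleftrightarrow>
     (\<forall>\<U>. countable \<U> \<and> (\<forall>U\<in>\<U>. openin X U \<and> X closure_of U = topspace X)
        \<longrightarrow> X closure_of (topspace X \<inter> \<Inter>\<U>) = topspace X)"

definition locally_comeagre_sets :: "'a topology \<Rightarrow> 'a set set" where
  "locally_comeagre_sets X =
     {H. H \<subseteq> topspace X \<and>
         (\<forall>x\<in>H. \<exists>U. openin X U \<and> x \<in> U \<and> meagre_in X (U - H))}"

text \<open>
  The function \<^const>\<open>topology\<close> is specified only on families satisfying \<^const>\<open>istopology\<close>;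
  that \<^const>\<open>locally_comeagre_sets\<close> is one has to be proved.
\<close>

definition locally_comeagre_topology :: "'a topology \<Rightarrow> 'a topology" where
  "locally_comeagre_topology X = topology (\<lambda>H. H \<in> locally_comeagre_sets X)"

definition weak_base :: "'a topology \<Rightarrow> 'a set set \<Rightarrow> bool" where
  "weak_base X \<W> \<longleftrightarrow>
     (\<forall>W\<in>\<W>. openin X W) \<and>
     (\<forall>V. openin X V \<and> V \<noteq> {} \<longrightarrow> (\<exists>W\<in>\<W>. W \<noteq> {} \<and> W \<subseteq> V))"

definition irrationals_topology :: "(nat \<Rightarrow> nat) topology" where
  "irrationals_topology = product_topology (\<lambda>_. discrete_topology UNIV) UNIV"

text \<open>The values of an upper-semicontinuous compact-valued map are allowed to be empty.\<close>

definition usco_map :: "'i topology \<Rightarrow> 'a topology \<Rightarrow> ('i \<Rightarrow> 'a set) \<Rightarrow> bool" where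
  "usco_map I X K \<longleftrightarrow>
     (\<forall>i\<in>topspace I. compactin X (K i) \<and>
        (\<forall>V. openin X V \<and> K i \<subseteq> V \<longrightarrow>
           (\<exists>W. openin I W \<and> i \<in> W \<and> (\<forall>j\<in>W. K j \<subseteq> V))))"

definition analytic_in :: "'a topology \<Rightarrow> 'a set \<Rightarrow> bool" where
  "analytic_in X A \<longleftrightarrow>
     (\<exists>K. usco_map irrationals_topology X K \<and> A = (\<Union>i\<in>topspace irrationals_topology. K i))"

end

theory Submission
  imports Defs
begin

text \<open>
  In a second countable space the Lindelof property makes a set that is locally comeagre at all of
  its points globally of the form \<open>U - M\<close> with \<open>U\<close> open and \<open>M\<close> meagre. Hence sets that are meagre
  for the new topology are meagre for the old one, and conversely if no non-empty open set is meagre.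
  In a separable metrizable group countably many translates of any non-empty open set cover the
  group, so either the whole group is meagre, and the new topology is discrete, or no non-empty
  open set is meagre. In the second case \<open>H = U - M\<close> and its translate \<open>tH\<close> intersect, up to a meagre
  set, in the open set \<open>U \<inter> tU\<close>, which contains the identity as soon as \<open>t\<inverse> \<in> U\<close>; this gives the
  Kemperman property.
\<close>

section \<open>Meagre sets\<close>

lemma nowhere_dense_in_subset:
  "nowhere_dense_in X S \<Longrightarrow> R \<subseteq> S \<Longrightarrow> nowhere_dense_in X R"
  unfolding nowhere_dense_in_def
  by (metis closure_of_mono interior_of_mono order_trans subset_empty)

lemma nowhere_dense_in_closure_of:
  "nowhere_dense_in X S \<Longrightarrow> nowhere_dense_in X (X closure_of S)"
  unfolding nowhere_dense_in_def by (simp add: closure_of_subset_topspace)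

lemma meagre_inI:
  "countable \<N> \<Longrightarrow> (\<And>N. N \<in> \<N> \<Longrightarrow> nowhere_dense_in X N) \<Longrightarrow> meagre_in X (\<Union>\<N>)"
  unfolding meagre_in_def by (intro exI[of _ \<N>]) simp

lemma nowhere_dense_in_imp_meagre_in: "nowhere_dense_in X S \<Longrightarrow> meagre_in X S"
  using meagre_inI[of "{S}" X] by simp

lemma meagre_in_subset_topspace: "meagre_in X S \<Longrightarrow> S \<subseteq> topspace X"
  unfolding meagre_in_def nowhere_dense_in_def by blast

lemma meagre_in_empty [simp]: "meagre_in X {}"
  using meagre_inI[of "{}" X] by simp

lemma meagre_in_subset:
  assumes "meagre_in X S" "R \<subseteq> S"
  shows "meagre_in X R"
proof -
  obtain \<N> where "countable \<N>" "\<forall>N\<in>\<N>. nowhere_dense_in X N" "S = \<Union>\<N>"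
    using assms(1) unfolding meagre_in_def by blast
  \<comment> \<open>\<open>meagre_in\<close> asks for an exact union, so the nowhere dense pieces
    are cut down to \<open>R\<close>.\<close>
  then have "meagre_in X (\<Union>((\<inter>) R ` \<N>))"
    by (intro meagre_inI) (auto intro: nowhere_dense_in_subset)
  moreover have "\<Union>((\<inter>) R ` \<N>) = R"
    using \<open>S = \<Union>\<N>\<close> assms(2) by blast
  ultimately show ?thesis
    by simp
qed

lemma meagre_in_Union:
  assumes "countable \<A>" "\<And>A. A \<in> \<A> \<Longrightarrow> meagre_in X A"
  shows "meagre_in X (\<Union>\<A>)"
proof -
  obtain f where f: "\<And>A. A \<in> \<A> \<Longrightarrow>
      countable (f A) \<and> (\<forall>N\<in>f A. nowhere_dense_in X N) \<and> A = \<Union>(f A)"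
    using assms(2) unfolding meagre_in_def by metis
  have f': "countable (f A)" "N \<in> f A \<Longrightarrow> nowhere_dense_in X N" if "A \<in> \<A>" for A N
    using f[OF that] by auto
  have "meagre_in X (\<Union>(\<Union>(f ` \<A>)))"
    using assms(1) f' by (intro meagre_inI) blast+
  moreover have "\<Union>(\<Union>(f ` \<A>)) = (\<Union>A\<in>\<A>. \<Union>(f A))"
    by blast
  moreover have "(\<Union>A\<in>\<A>. \<Union>(f A)) = (\<Union>A\<in>\<A>. A)"
    by (rule SUP_cong[OF refl]) (use f in metis)
  ultimately show ?thesis
    by simp
qed

lemma meagre_in_Un:
  "meagre_in X A \<Longrightarrow> meagre_in X B \<Longrightarrow> meagre_in X (A \<union> B)"
  using meagre_in_Union[of "{A, B}" X] by auto

lemma meagre_in_homeomorphic_image: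
  assumes h: "homeomorphic_map X Y h" and "meagre_in X S"
  shows "meagre_in Y (h ` S)"
proof -
  obtain \<N> where \<N>: "countable \<N>" "\<forall>N\<in>\<N>. nowhere_dense_in X N" "S = \<Union>\<N>"
    using assms(2) unfolding meagre_in_def by blast
  have "nowhere_dense_in Y (h ` N)" if "nowhere_dense_in X N" for N
    using that h homeomorphic_imp_surjective_map[OF h]
    unfolding nowhere_dense_in_def
    by (auto simp: homeomorphic_map_closure_of homeomorphic_map_interior_of closure_of_subset_topspace)
  then have "meagre_in Y (\<Union>((`) h ` \<N>))"
    using \<N>(1,2) by (intro meagre_inI) auto
  then show ?thesis
    using \<N>(3) by (simp add: image_Union)
qed

text \<open>Lindelof argument: every neighbourhood can be shrunk to a member of a countable base, so
  the countably many basic sets with meagre trace on \<open>S\<close> already cover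
  \<open>S\<close>.\<close>

lemma meagre_in_locally:
  assumes X: "second_countable X"
    and loc: "\<And>x. x \<in> S \<Longrightarrow> \<exists>U. openin X U \<and> x \<in> U \<and> meagre_in X (U \<inter> S)"
  shows "meagre_in X S"
proof -
  obtain \<B> where \<B>: "countable \<B>" "\<forall>U x. openin X U \<and> x \<in> U \<longrightarrow> (\<exists>V\<in>\<B>. x \<in> V \<and> V \<subseteq> U)"
    using X unfolding second_countable_def by blast
  define \<A> where "\<A> = {V \<inter> S |V. V \<in> \<B> \<and> meagre_in X (V \<inter> S)}"
  have "\<A> \<subseteq> (\<lambda>V. V \<inter> S) ` \<B>"
    unfolding \<A>_def by blast
  then have "countable \<A>"
    by (rule countable_subset) (intro countable_image \<B>(1))
  moreover have "S \<subseteq> \<Union>\<A>"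
  proof
    fix x assume x: "x \<in> S"
    obtain U where U: "openin X U" "x \<in> U" "meagre_in X (U \<inter> S)"
      using loc[OF x] by blast
    then obtain V where V: "V \<in> \<B>" "x \<in> V" "V \<subseteq> U"
      using \<B>(2) by blast
    then have "meagre_in X (V \<inter> S)"
      by (intro meagre_in_subset[OF U(3)]) blast
    then show "x \<in> \<Union>\<A>"
      using V x unfolding \<A>_def by blast
  qed
  moreover have "meagre_in X A" if "A \<in> \<A>" for A
    using that unfolding \<A>_def by blast
  ultimately show ?thesis
    using meagre_in_subset[OF meagre_in_Union] by metis
qed

section \<open>The topology of locally comeagre sets\<close>

lemma openin_imp_locally_comeagre: "openin X U \<Longrightarrow> U \<in> locally_comeagre_sets X"
  unfolding locally_comeagre_sets_def using openin_subset by fastforce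

lemma istopology_locally_comeagre_sets: "istopology (\<lambda>H. H \<in> locally_comeagre_sets X)"
  unfolding istopology_def
proof (intro conjI allI impI)
  fix H K assume HK: "H \<in> locally_comeagre_sets X" "K \<in> locally_comeagre_sets X"
  have "\<exists>W. openin X W \<and> x \<in> W \<and> meagre_in X (W - H \<inter> K)" if x: "x \<in> H \<inter> K" for x
  proof -
    obtain U V where "openin X U" "x \<in> U" "meagre_in X (U - H)"
        "openin X V" "x \<in> V" "meagre_in X (V - K)"
      using x HK unfolding locally_comeagre_sets_def by blast
    moreover have "U \<inter> V - H \<inter> K \<subseteq> (U - H) \<union> (V - K)"
      by blast
    ultimately show ?thesis
      by (meson IntI meagre_in_Un meagre_in_subset openin_Int)
  qed
  then show "H \<inter> K \<in> locally_comeagre_sets X"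
    using HK unfolding locally_comeagre_sets_def by blast
next
  fix \<K> assume \<K>: "\<forall>H\<in>\<K>. H \<in> locally_comeagre_sets X"
  have "\<exists>U. openin X U \<and> x \<in> U \<and> meagre_in X (U - \<Union>\<K>)" if x: "x \<in> \<Union>\<K>" for x
  proof -
    obtain H where H: "H \<in> \<K>" "x \<in> H"
      using x by (rule UnionE)
    then have "H \<in> locally_comeagre_sets X"
      using \<K> by simp
    then obtain U where U: "openin X U" "x \<in> U" "meagre_in X (U - H)"
      using H(2) unfolding locally_comeagre_sets_def by blast
    have "meagre_in X (U - \<Union>\<K>)"
      by (rule meagre_in_subset[OF U(3)]) (use H(1) in blast)
    then show ?thesis
      using U(1,2) by auto
  qed
  moreover have "\<Union>\<K> \<subseteq> topspace X"
    using \<K> unfolding locally_comeagre_sets_def by auto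
  ultimately show "\<Union>\<K> \<in> locally_comeagre_sets X"
    unfolding locally_comeagre_sets_def by (intro CollectI conjI ballI)
qed

lemma openin_locally_comeagre_topology:
  "openin (locally_comeagre_topology X) H \<longleftrightarrow> H \<in> locally_comeagre_sets X"
  by (simp add: locally_comeagre_topology_def istopology_locally_comeagre_sets)

lemma topspace_locally_comeagre_topology [simp]:
  "topspace (locally_comeagre_topology X) = topspace X"
proof
  show "topspace (locally_comeagre_topology X) \<subseteq> topspace X"
    by (metis (no_types, lifting) locally_comeagre_sets_def mem_Collect_eq
        openin_locally_comeagre_topology openin_topspace)
  show "topspace X \<subseteq> topspace (locally_comeagre_topology X)"
    by (simp add: openin_imp_locally_comeagre openin_locally_comeagre_topology openin_subset)
qed

section \<open>Locally comeagre sets as open sets minus meagre sets\<close>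

lemma open_Diff_meagre_locally_comeagre:
  assumes "openin X U" "meagre_in X M"
  shows "U - M \<in> locally_comeagre_sets X"
proof -
  have "meagre_in X (U - (U - M))"
    by (rule meagre_in_subset[OF assms(2)]) blast
  then show ?thesis
    using assms(1) openin_subset[OF assms(1)] unfolding locally_comeagre_sets_def by blast
qed

text \<open>Homeomorphisms preserve openness and meagreness, hence everything defined from them.
  Left translations are the intended instances.\<close>

lemma locally_comeagre_sets_image:
  assumes h: "homeomorphic_map X Y h" and "H \<in> locally_comeagre_sets X"
  shows "h ` H \<in> locally_comeagre_sets Y"
proof -
  have HX: "H \<subseteq> topspace X"
    using assms(2) unfolding locally_comeagre_sets_def by blast
  have inj: "inj_on h (topspace X)"
    using h by (simp add: homeomorphic_imp_injective_map)
  have "\<exists>V. openin Y V \<and> h x \<in> V \<and> meagre_in Y (V - h ` H)" if x: "x \<in> H" for x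
  proof -
    obtain U where U: "openin X U" "x \<in> U" "meagre_in X (U - H)"
      using x assms(2) unfolding locally_comeagre_sets_def by blast
    have "h ` U - h ` H = h ` (U - H)"
      by (rule inj_on_image_set_diff[symmetric, OF inj]) (use HX openin_subset[OF U(1)] in auto)
    then have "meagre_in Y (h ` U - h ` H)"
      using meagre_in_homeomorphic_image[OF h U(3)] by simp
    moreover have "openin Y (h ` U)"
      using U(1) h homeomorphic_map_openness_eq by blast
    ultimately show ?thesis
      using U(2) by blast
  qed
  then show ?thesis
    using HX homeomorphic_imp_surjective_map[OF h] unfolding locally_comeagre_sets_def by blast
qed

text \<open>Let \<open>U\<close> be the union of all open sets in which \<open>H\<close> is
  comeagre. Each of them meets \<open>U - H\<close> in a meagre set, so \<open>U - H\<close> is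
  locally meagre and therefore meagre.\<close>

lemma locally_comeagre_setsE:
  assumes "second_countable X" "H \<in> locally_comeagre_sets X"
  obtains U M where "openin X U" "meagre_in X M" "M \<subseteq> U" "H = U - M"
proof -
  define \<U> where "\<U> = {U. openin X U \<and> meagre_in X (U - H)}"
  have op: "openin X (\<Union>\<U>)"
    unfolding \<U>_def by blast
  have sub: "H \<subseteq> \<Union>\<U>"
    using assms(2) unfolding \<U>_def locally_comeagre_sets_def by blast
  have "meagre_in X (\<Union>\<U> - H)"
  proof (rule meagre_in_locally[OF assms(1)])
    fix x assume "x \<in> \<Union>\<U> - H"
    then obtain U where U: "openin X U" "meagre_in X (U - H)" "x \<in> U"
      unfolding \<U>_def by blast
    have "meagre_in X (U \<inter> (\<Union>\<U> - H))"
      by (rule meagre_in_subset[OF U(2)]) blast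
    then show "\<exists>U. openin X U \<and> x \<in> U \<and> meagre_in X (U \<inter> (\<Union>\<U> - H))"
      using U by blast
  qed
  then show ?thesis
    by (rule that[OF op]) (use sub in blast)+
qed

lemma locally_comeagre_baire_property:
  assumes "second_countable X" "H \<in> locally_comeagre_sets X"
  shows "baire_property_in X H"
proof -
  obtain U M where UM: "openin X U" "meagre_in X M" "M \<subseteq> U" "H = U - M"
    using locally_comeagre_setsE[OF assms] .
  have "(H - U) \<union> (U - H) = M"
    using UM(3) unfolding UM(4) by blast
  then show ?thesis
    using UM openin_subset[OF UM(1)] unfolding baire_property_in_def by blast
qed

section \<open>Baire property and interiors in the new topology\<close>

lemma locally_comeagre_interior_of_Int:
  assumes "openin X U" "meagre_in X (U - S)"
  shows "S \<inter> U \<subseteq> locally_comeagre_topology X interior_of (S \<inter> U)"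
proof -
  have "S \<inter> U = U - (U - S)"
    by blast
  then have "openin (locally_comeagre_topology X) (S \<inter> U)"
    using assms
    by (metis open_Diff_meagre_locally_comeagre openin_locally_comeagre_topology)
  then show ?thesis
    by (simp add: interior_of_openin)
qed

lemma baire_property_in_Diff_interior_of:
  assumes "baire_property_in X H"
  shows "meagre_in X (H - locally_comeagre_topology X interior_of H)"
proof -
  obtain U where U: "openin X U" "meagre_in X ((H - U) \<union> (U - H))"
    using assms unfolding baire_property_in_def by blast
  then have "meagre_in X (U - H)"
    by (meson Un_upper2 meagre_in_subset)
  then have "H \<inter> U \<subseteq> locally_comeagre_topology X interior_of H"
    using locally_comeagre_interior_of_Int[OF U(1)] interior_of_mono[of "H \<inter> U" H] by blast
  then show ?thesis
    by (intro meagre_in_subset[OF U(2)]) blast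
qed

text \<open>Let the open set \<open>U\<close> equal \<open>S\<close> modulo a meagre set. Then
  \<open>S \<inter> (U \<inter> V)\<close> is open in the new topology. Were it empty,
  \<open>S \<inter> V\<close> would lie in the meagre set \<open>S - U\<close>.\<close>

lemma baire_property_in_interior_of_Int:
  assumes S: "baire_property_in X S" and V: "openin X V" and nm: "\<not> meagre_in X (S \<inter> V)"
  shows "locally_comeagre_topology X interior_of (S \<inter> V) \<noteq> {}"
proof -
  obtain U where U: "openin X U" "meagre_in X ((S - U) \<union> (U - S))"
    using S unfolding baire_property_in_def by blast
  have "meagre_in X (U \<inter> V - S)"
    by (rule meagre_in_subset[OF U(2)]) blast
  then have "S \<inter> (U \<inter> V) \<subseteq> locally_comeagre_topology X interior_of (S \<inter> V)"
    using locally_comeagre_interior_of_Int[of X "U \<inter> V" S] U(1) V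
      interior_of_mono[of "S \<inter> (U \<inter> V)" "S \<inter> V"] by blast
  moreover have "S \<inter> (U \<inter> V) \<noteq> {}"
  proof
    assume "S \<inter> (U \<inter> V) = {}"
    then have "S \<inter> V \<subseteq> (S - U) \<union> (U - S)"
      by blast
    then show False
      using nm meagre_in_subset[OF U(2)] by blast
  qed
  ultimately show ?thesis
    by blast
qed

section \<open>Comparison of the two notions of meagre set\<close>

text \<open>Write the complement of the new closure of \<open>N\<close> as \<open>U - M\<close>. The
  old interior of the complement of \<open>U\<close> is also open in the new topology and lies in
  that closure, so it is empty. Thus \<open>N\<close> is covered by a closed nowhere dense set and
  \<open>M\<close>.\<close>

lemma nowhere_dense_locally_comeagre_imp_meagre:
  assumes "second_countable X" and N: "nowhere_dense_in (locally_comeagre_topology X) N"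
  shows "meagre_in X N"
proof -
  let ?D = "locally_comeagre_topology X"
  have "topspace X - ?D closure_of N \<in> locally_comeagre_sets X"
    using openin_locally_comeagre_topology closedin_closure_of[of ?D N]
    by (metis closedin_def topspace_locally_comeagre_topology)
  then obtain U M where UM: "openin X U" "meagre_in X M"
      "topspace X - ?D closure_of N = U - M"
    using locally_comeagre_setsE[OF assms(1)] by metis
  have cl: "closedin X (topspace X - U)"
    using UM(1) by blast
  have "X interior_of (topspace X - U) \<subseteq> ?D closure_of N"
    using UM(3) interior_of_subset[of X "topspace X - U"] by blast
  moreover have "openin ?D (X interior_of (topspace X - U))"
    by (simp add: openin_imp_locally_comeagre openin_locally_comeagre_topology)
  ultimately have "X interior_of (topspace X - U) = {}"
    using N interior_of_maximal unfolding nowhere_dense_in_def by blast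
  then have "nowhere_dense_in X (topspace X - U)"
    unfolding nowhere_dense_in_def by (simp add: closure_of_closedin[OF cl])
  then have "meagre_in X ((topspace X - U) \<union> M)"
    by (intro meagre_in_Un nowhere_dense_in_imp_meagre_in UM(2))
  moreover have "N \<subseteq> ?D closure_of N" "N \<subseteq> topspace X"
    using N closure_of_subset[of N ?D] unfolding nowhere_dense_in_def by auto
  ultimately show ?thesis
    using UM(3) by (elim meagre_in_subset) blast
qed

lemma meagre_locally_comeagre_imp_meagre:
  assumes "second_countable X" "meagre_in (locally_comeagre_topology X) S"
  shows "meagre_in X S"
proof -
  obtain \<N> where "countable \<N>" "S = \<Union>\<N>"
      "\<forall>N\<in>\<N>. nowhere_dense_in (locally_comeagre_topology X) N"
    using assms(2) unfolding meagre_in_def by blast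
  then show ?thesis
    using nowhere_dense_locally_comeagre_imp_meagre[OF assms(1)] by (auto intro: meagre_in_Union)
qed

text \<open>A meagre set is closed in the new topology, its complement being open minus meagre. Its
  new interior has the form \<open>U - M\<close>, which makes \<open>U\<close> meagre and so empty.
  Together with the preceding lemmas, meagre in either topology then means nowhere dense in the new
  one.\<close>

lemma meagre_imp_nowhere_dense_locally_comeagre:
  assumes X: "second_countable X"
    and nm: "\<And>U. openin X U \<Longrightarrow> U \<noteq> {} \<Longrightarrow> \<not> meagre_in X U"
    and S: "meagre_in X S"
  shows "nowhere_dense_in (locally_comeagre_topology X) S"
proof -
  let ?D = "locally_comeagre_topology X"
  have SX: "S \<subseteq> topspace X"
    using S by (rule meagre_in_subset_topspace)
  have "openin ?D (topspace X - S)"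
    using S open_Diff_meagre_locally_comeagre openin_locally_comeagre_topology by blast
  then have cl: "?D closure_of S = S"
    using SX by (simp add: closedin_def closure_of_closedin)
  have "?D interior_of S = {}"
  proof (rule ccontr)
    assume ne: "?D interior_of S \<noteq> {}"
    have "?D interior_of S \<in> locally_comeagre_sets X"
      unfolding openin_locally_comeagre_topology[symmetric] by simp
    then obtain U M where UM: "openin X U" "meagre_in X M" "?D interior_of S = U - M"
      by (rule locally_comeagre_setsE[OF X])
    then have "U \<subseteq> S \<union> M"
      using interior_of_subset[of ?D S] by blast
    then have "meagre_in X U"
      using meagre_in_subset[OF meagre_in_Un[OF S UM(2)]] by blast
    then show False
      using nm UM ne by blast
  qed
  then show ?thesis
    using cl SX unfolding nowhere_dense_in_def by simp
qed

text \<open>Every subset is the whole space minus a meagre set. This is the degenerate case, as for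
  the rationals.\<close>

lemma locally_comeagre_eq_discrete:
  assumes "meagre_in X (topspace X)"
  shows "locally_comeagre_topology X = discrete_topology (topspace X)"
proof -
  have "H \<in> locally_comeagre_sets X" if "H \<subseteq> topspace X" for H
  proof -
    have "H = topspace X - (topspace X - H)"
      using that by blast
    then show ?thesis
      by (metis Diff_subset assms meagre_in_subset open_Diff_meagre_locally_comeagre openin_topspace)
  qed
  then show ?thesis
    unfolding topology_eq openin_locally_comeagre_topology
    by (auto simp: locally_comeagre_sets_def)
qed

lemma baire_space_discrete_topology: "baire_space (discrete_topology S)"
  unfolding baire_space_def by (auto simp: discrete_topology_closure_of)

text \<open>Complements of dense open sets are nowhere dense in the new topology, hence meagre in
  the old one. So is their countable union, which is therefore again nowhere dense in the new
  topology.\<close>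

lemma baire_space_locally_comeagre:
  assumes X: "second_countable X"
    and nm: "\<And>U. openin X U \<Longrightarrow> U \<noteq> {} \<Longrightarrow> \<not> meagre_in X U"
  shows "baire_space (locally_comeagre_topology X)"
  unfolding baire_space_def
proof (intro allI impI)
  let ?D = "locally_comeagre_topology X"
  fix \<U> assume \<U>: "countable \<U> \<and> (\<forall>U\<in>\<U>. openin ?D U \<and> ?D closure_of U = topspace ?D)"
  have "meagre_in X (topspace X - U)" if "U \<in> \<U>" for U
  proof -
    have "openin ?D U" and cl: "?D closure_of U = topspace X"
      using \<U> that by auto
    then have "?D closure_of (topspace X - U) = topspace X - U"
      by (metis closedin_diff closedin_topspace closure_of_closedin topspace_locally_comeagre_topology)
    moreover have "?D interior_of (topspace X - U) = {}"
      using interior_of_complement[of ?D U] cl by simp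
    ultimately show ?thesis
      by (intro nowhere_dense_locally_comeagre_imp_meagre[OF X]) (simp add: nowhere_dense_in_def)
  qed
  then have "meagre_in X (\<Union>((-) (topspace X) ` \<U>))"
    using \<U> by (intro meagre_in_Union) auto
  moreover have "\<Union>((-) (topspace X) ` \<U>) = topspace X - topspace X \<inter> \<Inter>\<U>"
    by blast
  ultimately have nd: "nowhere_dense_in ?D (topspace X - topspace X \<inter> \<Inter>\<U>)"
    using meagre_imp_nowhere_dense_locally_comeagre[OF X nm] by metis
  have "?D interior_of (topspace X - topspace X \<inter> \<Inter>\<U>) = {}"
    using nd interior_of_mono[OF closure_of_subset] unfolding nowhere_dense_in_def by blast
  then have "topspace X - ?D closure_of (topspace X \<inter> \<Inter>\<U>) = {}"
    using interior_of_complement[of ?D "topspace X \<inter> \<Inter>\<U>"] by simp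
  then show "?D closure_of (topspace ?D \<inter> \<Inter>\<U>) = topspace ?D"
    using closure_of_subset_topspace[of ?D] by fastforce
qed

section \<open>Weak bases of G-delta sets\<close>

text \<open>Closures of nowhere dense sets are nowhere dense; replacing each piece of
  \<open>M\<close> by its closure gives a meagre F-sigma set.\<close>

lemma open_Diff_meagre_contains_gdelta:
  assumes U: "openin X U" and M: "meagre_in X M"
  obtains M' where "meagre_in X M'" "M \<subseteq> M'" "gdelta_in X (U - M')"
proof -
  obtain \<N> where \<N>: "countable \<N>" "\<forall>N\<in>\<N>. nowhere_dense_in X N" "M = \<Union>\<N>"
    using M unfolding meagre_in_def by blast
  define M' where "M' = \<Union>((closure_of) X ` \<N>)"
  have "meagre_in X M'"
    unfolding M'_def using \<N>(1,2)
    by (intro meagre_in_Union)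
      (auto intro: nowhere_dense_in_imp_meagre_in nowhere_dense_in_closure_of)
  moreover have "M \<subseteq> M'"
    using \<N>(2,3) closure_of_subset unfolding M'_def nowhere_dense_in_def by fastforce
  moreover have "fsigma_in X M'"
    unfolding M'_def using \<N>(1) by (intro fsigma_in_Union) (auto intro: closed_imp_fsigma_in)
  then have "gdelta_in X (U - M')"
    using U by (simp add: gdelta_in_diff open_imp_gdelta_in)
  ultimately show ?thesis
    using that by blast
qed

lemma weak_base_locally_comeagre_gdelta:
  assumes X: "second_countable X"
    and nm: "\<And>U. openin X U \<Longrightarrow> U \<noteq> {} \<Longrightarrow> \<not> meagre_in X U"
  shows "weak_base (locally_comeagre_topology X) (locally_comeagre_sets X \<inter> {W. gdelta_in X W})"
  unfolding weak_base_def openin_locally_comeagre_topology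
proof (intro conjI allI impI ballI)
  fix V assume V: "V \<in> locally_comeagre_sets X \<and> V \<noteq> {}"
  then obtain U M where UM: "openin X U" "meagre_in X M" "V = U - M"
    using locally_comeagre_setsE[OF X] by metis
  obtain M' where M': "meagre_in X M'" "M \<subseteq> M'" "gdelta_in X (U - M')"
    using open_Diff_meagre_contains_gdelta[OF UM(1,2)] .
  \<comment> \<open>Otherwise the non-empty open set \<open>U\<close> would lie in the meagre set
    \<open>M'\<close>.\<close>
  have "U - M' \<noteq> {}"
    using nm[OF UM(1)] V UM(3) meagre_in_subset[OF M'(1)] by blast
  then show "\<exists>W\<in>locally_comeagre_sets X \<inter> {W. gdelta_in X W}. W \<noteq> {} \<and> W \<subseteq> V"
    using M' UM open_Diff_meagre_locally_comeagre[OF UM(1) M'(1)]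
    by (intro bexI[of _ "U - M'"]) auto
qed auto

text \<open>The new topology is discrete, and singletons are closed, hence G-delta, in a metrizable
  space.\<close>

lemma weak_base_locally_comeagre_gdelta_discrete:
  assumes X: "metrizable_space X" and "meagre_in X (topspace X)"
  shows "weak_base (locally_comeagre_topology X) (locally_comeagre_sets X \<inter> {W. gdelta_in X W})"
  unfolding weak_base_def
proof (intro conjI allI impI ballI)
  note D = locally_comeagre_eq_discrete[OF assms(2)]
  fix V assume "openin (locally_comeagre_topology X) V \<and> V \<noteq> {}"
  then obtain x where x: "x \<in> V" "x \<in> topspace X"
    unfolding D by auto
  have "closedin X {x}"
    using metrizable_imp_t1_space[OF X] x(2) by (simp add: t1_space_closedin_singleton)
  then have "gdelta_in X {x}"
    by (rule closed_imp_gdelta_in[OF X])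
  moreover have "{x} \<in> locally_comeagre_sets X"
    using x(2) unfolding openin_locally_comeagre_topology[symmetric] D by simp
  ultimately show "\<exists>W\<in>locally_comeagre_sets X \<inter> {W. gdelta_in X W}. W \<noteq> {} \<and> W \<subseteq> V"
    using x by (intro bexI[of _ "{x}"]) auto
qed (simp_all only: openin_locally_comeagre_topology Int_iff)

section \<open>Analytic sets\<close>

lemma topspace_irrationals [simp]: "topspace irrationals_topology = UNIV"
  unfolding irrationals_topology_def by simp

text \<open>The first coordinate of a sequence selects one of the closed sets whose union is
  \<open>S\<close>, and the remaining coordinates are passed to \<open>K\<close>. The use intended
  is for open \<open>S\<close> in a metrizable space.\<close>

lemma analytic_in_Int_fsigma:
  assumes "analytic_in X A" "fsigma_in X S"
  shows "analytic_in X (A \<inter> S)"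
proof -
  obtain K where K: "usco_map irrationals_topology X K" "A = (\<Union>i. K i)"
    using assms(1) unfolding analytic_in_def by auto
  obtain C where C: "\<And>n::nat. closedin X (C n)" "\<Union>(range C) = S"
    using assms(2) unfolding fsigma_in_ascending by metis
  define L where "L i = K (i \<circ> Suc) \<inter> C (i 0)" for i
  have shift: "continuous_map irrationals_topology irrationals_topology (\<lambda>i. i \<circ> Suc)"
    unfolding irrationals_topology_def
    by (auto simp: continuous_map_componentwise_UNIV comp_def intro: continuous_map_product_projection)
  have head: "continuous_map irrationals_topology (discrete_topology UNIV) (\<lambda>i. i 0)"
    unfolding irrationals_topology_def by (auto intro: continuous_map_product_projection)
  have "usco_map irrationals_topology X L"
    unfolding usco_map_def
  proof (intro ballI conjI allI impI)
    fix i
    show "compactin X (L i)"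
      using K(1) C(1) unfolding L_def usco_map_def by (auto intro: compact_Int_closedin)
    fix V assume V: "openin X V \<and> L i \<subseteq> V"
    have Ki: "K (i \<circ> Suc) \<subseteq> topspace X"
      using K(1) compactin_subset_topspace unfolding usco_map_def by fastforce
    \<comment> \<open>Only the part of \<open>K (i \<circ> Suc)\<close> inside
      \<open>C (i 0)\<close> is known to lie in \<open>V\<close>. Adding the open complement of
      \<open>C (i 0)\<close> covers all of it, so that semicontinuity of \<open>K\<close>
      applies.\<close>
    let ?V = "V \<union> (topspace X - C (i 0))"
    have "openin X ?V" "K (i \<circ> Suc) \<subseteq> ?V"
      using V C(1) Ki unfolding L_def by auto
    then obtain W where W: "openin irrationals_topology W" "i \<circ> Suc \<in> W" "\<forall>j\<in>W. K j \<subseteq> ?V"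
      using K(1) unfolding usco_map_def by (metis UNIV_I topspace_irrationals)
    \<comment> \<open>Fixing the first coordinate keeps the closed set the same for all
      \<open>j\<close>, so the part added in \<open>?V\<close> is cut away again.\<close>
    define W' where "W' = {j. j \<circ> Suc \<in> W} \<inter> {j. j 0 = i 0}"
    have "openin irrationals_topology {j. j \<circ> Suc \<in> W}"
      using openin_continuous_map_preimage[OF shift W(1)] by simp
    moreover have "openin irrationals_topology {j. j 0 = i 0}"
      using openin_continuous_map_preimage[OF head, of "{i 0}"] by simp
    ultimately have "openin irrationals_topology W'"
      unfolding W'_def by blast
    moreover have "i \<in> W'"
      using W(2) unfolding W'_def by simp
    moreover have "\<forall>j\<in>W'. L j \<subseteq> V"
      using W(3) unfolding L_def W'_def by fastforce
    ultimately show "\<exists>W. openin irrationals_topology W \<and> i \<in> W \<and> (\<forall>j\<in>W. L j \<subseteq> V)"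
      by blast
  qed
  moreover have "A \<inter> S = (\<Union>i. L i)"
  proof
    show "A \<inter> S \<subseteq> (\<Union>i. L i)"
    proof
      fix x assume "x \<in> A \<inter> S"
      then obtain i n where "x \<in> K i" "x \<in> C n"
        using K(2) C(2) by blast
      \<comment> \<open>\<open>case_nat n i\<close> is the sequence \<open>i\<close> with
        \<open>n\<close> put in front.\<close>
      moreover have "case_nat n i \<circ> Suc = i"
        by auto
      ultimately have "x \<in> L (case_nat n i)"
        unfolding L_def by simp
      then show "x \<in> (\<Union>i. L i)"
        by blast
    qed
    show "(\<Union>i. L i) \<subseteq> A \<inter> S"
      using K(2) C(2) unfolding L_def by blast
  qed
  ultimately show ?thesis
    unfolding analytic_in_def by auto
qed

text \<open>Modulo sets meagre in the new topology, \<open>S\<close> equals some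
  \<open>U - M\<close> and hence \<open>U\<close>, because \<open>M\<close> is meagre there too. The
  open set \<open>U\<close> is F-sigma, so it inherits analyticity from the whole space.\<close>

lemma baire_property_locally_comeagre_analytic:
  assumes X: "second_countable X" "metrizable_space X"
    and nm: "\<And>U. openin X U \<Longrightarrow> U \<noteq> {} \<Longrightarrow> \<not> meagre_in X U"
    and an: "analytic_in X (topspace X)"
    and S: "baire_property_in (locally_comeagre_topology X) S"
  shows "\<exists>A. analytic_in X A \<and> meagre_in (locally_comeagre_topology X) ((S - A) \<union> (A - S))"
proof -
  let ?D = "locally_comeagre_topology X"
  obtain W where W: "openin ?D W" "meagre_in ?D ((S - W) \<union> (W - S))"
    using S unfolding baire_property_in_def by blast
  have "W \<in> locally_comeagre_sets X"
    using W(1) by (simp add: openin_locally_comeagre_topology)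
  then obtain U M where UM: "openin X U" "meagre_in X M" "W = U - M"
    by (rule locally_comeagre_setsE[OF X(1)])
  have "meagre_in ?D M"
    by (intro nowhere_dense_in_imp_meagre_in meagre_imp_nowhere_dense_locally_comeagre X nm UM)
  then have "meagre_in ?D (((S - W) \<union> (W - S)) \<union> M)"
    using W(2) by (rule_tac meagre_in_Un)
  then have "meagre_in ?D ((S - U) \<union> (U - S))"
    by (rule meagre_in_subset) (use UM in blast)
  moreover have "analytic_in X (topspace X \<inter> U)"
    using X(2) UM(1) an by (intro analytic_in_Int_fsigma open_imp_fsigma_in)
  then have "analytic_in X U"
    using openin_subset[OF UM(1)] by (simp add: Int_absorb1)
  ultimately show ?thesis
    by blast
qed

section \<open>Topological groups\<close>

lemma (in Metric_space) separable_imp_second_countable: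
  assumes "separable_space mtopology"
  shows "second_countable mtopology"
proof -
  obtain C where C: "countable C" "C \<subseteq> M" "mtopology closure_of C = M"
    using assms unfolding separable_space_def by auto
  define \<B> where "\<B> = (\<lambda>(c, n). mball c (1 / Suc n)) ` (C \<times> (UNIV :: nat set))"
  have "countable \<B>"
    unfolding \<B>_def using C(1) by auto
  moreover have "\<forall>V\<in>\<B>. openin mtopology V"
    unfolding \<B>_def by auto
  moreover have "\<exists>V\<in>\<B>. x \<in> V \<and> V \<subseteq> U" if U: "openin mtopology U" "x \<in> U" for U x
  proof -
    have xM: "x \<in> M"
      using U openin_subset by fastforce
    obtain r where r: "r > 0" "mball x r \<subseteq> U"
      using U unfolding openin_mtopology by blast
    \<comment> \<open>Half of \<open>r\<close>: the ball about \<open>c\<close> must contain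
      \<open>x\<close> and still fit inside the ball of radius \<open>r\<close> about
      \<open>x\<close>.\<close>
    obtain n :: nat where n: "1 / Suc n < r / 2"
      using r(1) by (metis half_gt_zero nat_approx_posE)
    have "x \<in> mtopology closure_of C"
      using C(3) xM by simp
    moreover have "1 / real (Suc n) > 0"
      by simp
    ultimately obtain c where c: "c \<in> C" "c \<in> mball x (1 / Suc n)"
      unfolding metric_closure_of by blast
    have cM: "c \<in> M"
      using c C(2) by blast
    have dxc: "d x c < 1 / Suc n"
      using c(2) by simp
    have "x \<in> mball c (1 / Suc n)"
      using dxc xM cM by (simp add: commute)
    moreover have "mball c (1 / Suc n) \<subseteq> mball x r"
    proof
      fix y assume y: "y \<in> mball c (1 / Suc n)"
      have "d x y \<le> d x c + d c y"
        using y xM cM by (intro triangle) auto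
      then show "y \<in> mball x r"
        using y dxc n xM by (auto simp del: of_nat_Suc)
    qed
    moreover have "mball c (1 / Suc n) \<in> \<B>"
      unfolding \<B>_def using c(1) by force
    ultimately show ?thesis
      using r(2) by blast
  qed
  ultimately show ?thesis
    unfolding second_countable_def by blast
qed

text \<open>The metric of the main result is only right-invariant, so left translations need not be
  isometries; their continuity comes from joint continuity of the multiplication.\<close>

lemma homeomorphic_map_left_translation:
  fixes G (structure)
  assumes tg: "topological_group_on G T" and t: "t \<in> carrier G"
  shows "homeomorphic_map T T (\<lambda>x. t \<otimes> x)"
proof -
  interpret group G
    using tg unfolding topological_group_on_def by blast
  have ts: "topspace T = carrier G"
    using tg unfolding topological_group_on_def by blast
  have cont: "continuous_map T T (\<lambda>x. s \<otimes> x)" if "s \<in> carrier G" for s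
  proof -
    have "continuous_map T (prod_topology T T) (\<lambda>x. (s, x))"
      using that ts by (simp add: continuous_map_pairedI)
    then show ?thesis
      using tg continuous_map_compose[of T "prod_topology T T" "\<lambda>x. (s, x)" T "\<lambda>(x, y). x \<otimes> y"]
      unfolding topological_group_on_def by (simp add: comp_def)
  qed
  have "homeomorphic_maps T T (\<lambda>x. t \<otimes> x) (\<lambda>x. inv t \<otimes> x)"
    unfolding homeomorphic_maps_def using t ts
    by (auto simp: cont m_assoc[symmetric])
  then show ?thesis
    unfolding homeomorphic_map_maps by blast
qed

text \<open>Left translation by \<open>x \<otimes> inv u\<close> moves a point \<open>u\<close> of
  \<open>U\<close> to \<open>x\<close>. If \<open>U\<close> were meagre, every point of the group
  would have a meagre open neighbourhood, and the group would be meagre.\<close>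

lemma topological_group_open_not_meagre:
  fixes G (structure)
  assumes tg: "topological_group_on G T" and T: "second_countable T"
    and nm: "\<not> meagre_in T (carrier G)"
    and U: "openin T U" "U \<noteq> {}"
  shows "\<not> meagre_in T U"
proof
  assume mU: "meagre_in T U"
  interpret group G
    using tg unfolding topological_group_on_def by blast
  have UG: "U \<subseteq> carrier G"
    using tg openin_subset[OF U(1)] unfolding topological_group_on_def by auto
  obtain u where u: "u \<in> U" "u \<in> carrier G"
    using U(2) UG by blast
  have "meagre_in T (carrier G)"
  proof (rule meagre_in_locally[OF T])
    fix x assume x: "x \<in> carrier G"
    define t where "t = x \<otimes> inv u"
    have t: "t \<in> carrier G"
      using x u t_def by simp
    note h = homeomorphic_map_left_translation[OF tg t]
    have "openin T ((\<lambda>y. t \<otimes> y) ` U)"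
      using U(1) h homeomorphic_map_openness_eq by blast
    moreover have "t \<otimes> u = x"
      using x u by (simp add: t_def m_assoc)
    then have "x \<in> (\<lambda>y. t \<otimes> y) ` U"
      using u(1) by blast
    moreover have "meagre_in T ((\<lambda>y. t \<otimes> y) ` U \<inter> carrier G)"
      by (rule meagre_in_subset[OF meagre_in_homeomorphic_image[OF h mU]]) blast
    ultimately show "\<exists>V. openin T V \<and> x \<in> V \<and> meagre_in T (V \<inter> carrier G)"
      by blast
  qed
  then show False
    using nm by blast
qed

section \<open>Translates and the Kemperman property\<close>

lemma l_coset_image: "t <#\<^bsub>G\<^esub> H = (\<lambda>x. t \<otimes>\<^bsub>G\<^esub> x) ` H"
  unfolding l_coset_def by blast

lemma locally_comeagre_l_coset:
  assumes "topological_group_on G T" "t \<in> carrier G" "H \<in> locally_comeagre_sets T"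
  shows "t <#\<^bsub>G\<^esub> H \<in> locally_comeagre_sets T"
  unfolding l_coset_image
  by (rule locally_comeagre_sets_image[OF homeomorphic_map_left_translation[OF assms(1,2)] assms(3)])

lemma kemperman_locally_comeagre:
  fixes G (structure)
  assumes tg: "topological_group_on G T" and T: "second_countable T"
    and ms: "Metric_space (carrier G) d" and Td: "T = Metric_space.mtopology (carrier G) d"
    and ri: "right_invariant G d"
    and nm: "\<not> meagre_in T (carrier G)"
    and H: "H \<in> locally_comeagre_sets T" "\<one> \<in> H"
  shows "\<exists>\<delta>>0. \<forall>t\<in>carrier G. d \<one> t < \<delta> \<longrightarrow>
    baire_property_in (locally_comeagre_topology T) (H \<inter> (t <# H)) \<and>
    \<not> meagre_in (locally_comeagre_topology T) (H \<inter> (t <# H))"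
proof -
  interpret group G
    using tg unfolding topological_group_on_def by blast
  interpret Metric_space "carrier G" d
    by (rule ms)
  obtain U M where UM: "openin T U" "meagre_in T M" "H = U - M"
    using locally_comeagre_setsE[OF T H(1)] by metis
  have "\<one> \<in> U"
    using H(2) UM(3) by blast
  \<comment> \<open>This radius serves as \<open>\<delta>\<close>. The ball lies in
    \<open>U\<close>, whereas \<open>H\<close> itself may contain no ball.\<close>
  then obtain r where r: "r > 0" "mball \<one> r \<subseteq> U"
    using UM(1) unfolding Td openin_mtopology by blast
  have "baire_property_in (locally_comeagre_topology T) (H \<inter> (t <# H)) \<and>
      \<not> meagre_in (locally_comeagre_topology T) (H \<inter> (t <# H))"
    if t: "t \<in> carrier G" "d \<one> t < r" for t
  proof
    note h = homeomorphic_map_left_translation[OF tg t(1)]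
    have op: "openin (locally_comeagre_topology T) (H \<inter> (t <# H))"
      using H(1) locally_comeagre_l_coset[OF tg t(1) H(1)]
      by (intro openin_Int) (simp_all add: openin_locally_comeagre_topology)
    then show "baire_property_in (locally_comeagre_topology T) (H \<inter> (t <# H))"
      using openin_subset[OF op] unfolding baire_property_in_def
      by (intro conjI exI[of _ "H \<inter> (t <# H)"]) auto
    let ?U = "U \<inter> (\<lambda>x. t \<otimes> x) ` U" and ?M = "M \<union> (\<lambda>x. t \<otimes> x) ` M"
    \<comment> \<open>Right translation of the pair \<open>t\<close>, \<open>\<one>\<close> by
      \<open>inv t\<close>.\<close>
    have "d \<one> (inv t) = d t \<one>"
      using ri t(1) unfolding right_invariant_def by (metis inv_closed l_one one_closed r_inv)
    then have "inv t \<in> mball \<one> r"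
      using t by (simp add: commute)
    then have "t \<otimes> inv t \<in> (\<lambda>x. t \<otimes> x) ` U"
      using r(2) by blast
    then have "\<one> \<in> ?U"
      using t(1) \<open>\<one> \<in> U\<close> by simp
    moreover have "openin T ?U"
      using UM(1) h homeomorphic_map_openness_eq by blast
    ultimately have nU: "\<not> meagre_in T ?U"
      using topological_group_open_not_meagre[OF tg T nm] by blast
    have mM: "meagre_in T ?M"
      by (intro meagre_in_Un UM(2) meagre_in_homeomorphic_image[OF h])
    \<comment> \<open>A point \<open>t \<otimes> y\<close> with \<open>y \<in> U\<close> that avoids
      the translate of \<open>M\<close> has \<open>y \<notin> M\<close>, hence
      \<open>y \<in> H\<close>.\<close>
    have sub: "?U \<subseteq> (H \<inter> (t <# H)) \<union> ?M"
      unfolding l_coset_image UM(3) by blast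
    show "\<not> meagre_in (locally_comeagre_topology T) (H \<inter> (t <# H))"
    proof
      assume "meagre_in (locally_comeagre_topology T) (H \<inter> (t <# H))"
      then have "meagre_in T (H \<inter> (t <# H))"
        by (rule meagre_locally_comeagre_imp_meagre[OF T])
      then show False
        using nU meagre_in_subset[OF meagre_in_Un[OF _ mM] sub] by blast
    qed
  qed
  then show ?thesis
    using r(1) by blast
qed

text \<open>Parts (iv) and (v) concern groups that are not meagre in themselves. On the rationals
  the new topology is discrete, and the open set consisting of the identity alone is disjoint from
  its other translates. In a discrete topology only the empty set is meagre, so (v) would ask every
  subset to be analytic.\<close>

theorem theorem1:
  fixes G :: "('a, 'b) monoid_scheme" (structure)
    and T :: "'a topology"
    and d :: "'a \<Rightarrow> 'a \<Rightarrow> real"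
  assumes "topological_group_on G T"
    and "separable_space T"
    and "Metric_space (carrier G) d"
    and "T = Metric_space.mtopology (carrier G) d"
    and "right_invariant G d"
  defines "\<D> \<equiv> locally_comeagre_sets T"
    and "D \<equiv> locally_comeagre_topology T"
  shows "istopology (\<lambda>H. H \<in> \<D>) \<and> topspace D = carrier G
    \<and> \<comment> \<open>(i)\<close>
      (\<forall>t\<in>carrier G. (\<lambda>V. t <# V) ` \<D> \<subseteq> \<D>) \<and> {U. openin T U} \<subseteq> \<D>
    \<and> \<comment> \<open>(ii)\<close>
      (\<forall>H\<in>\<D>. baire_property_in T H)
    \<and> \<comment> \<open>(iii)\<close>
      (\<forall>H. baire_property_in T H \<longrightarrow> meagre_in T (H - D interior_of H))
    \<and> (\<forall>S V. baire_property_in T S \<and> openin T V \<and> V \<noteq> {}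
          \<and> V \<subseteq> T closure_of (S \<inter> V) \<and> \<not> meagre_in T (S \<inter> V)
          \<longrightarrow> D interior_of (S \<inter> V) \<noteq> {})
    \<and> \<comment> \<open>(iv)\<close>
      (\<not> meagre_in T (carrier G) \<longrightarrow>
        (\<forall>H\<in>\<D>. \<one> \<in> H \<longrightarrow>
          (\<exists>\<delta>>0. \<forall>t\<in>carrier G. d \<one> t < \<delta> \<longrightarrow>
             baire_property_in D (H \<inter> (t <# H)) \<and> \<not> meagre_in D (H \<inter> (t <# H)))))
    \<and> \<comment> \<open>(v)\<close>
      (\<not> meagre_in T (carrier G) \<and> analytic_in T (carrier G) \<longrightarrow>
        (\<forall>S. baire_property_in D S \<longrightarrow>
          (\<exists>A. analytic_in T A \<and> meagre_in D ((S - A) \<union> (A - S)))))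
    \<and> weak_base D (\<D> \<inter> {W. gdelta_in T W})
    \<and> baire_space D"
proof -
  interpret M: Metric_space "carrier G" d
    by (rule assms(3))
  note tg = assms(1)
  have T: "second_countable T"
    using M.separable_imp_second_countable assms(2,4) by simp
  have met: "metrizable_space T"
    using assms(4) M.metrizable_space_mtopology by simp
  have ts: "topspace T = carrier G"
    using assms(4) by simp
  have base_baire: "weak_base D (\<D> \<inter> {W. gdelta_in T W}) \<and> baire_space D"
  \<comment> \<open>If the group is meagre, the new topology is discrete; otherwise no non-empty
    open set is meagre.\<close>
  proof (cases "meagre_in T (carrier G)")
    case True
    then have "meagre_in T (topspace T)"
      by (simp add: ts)
    then show ?thesis
      unfolding D_def \<D>_def
      using weak_base_locally_comeagre_gdelta_discrete[OF met] baire_space_discrete_topology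
      by (metis locally_comeagre_eq_discrete)
  next
    case False
    show ?thesis
      unfolding D_def \<D>_def
      using weak_base_locally_comeagre_gdelta[OF T] baire_space_locally_comeagre[OF T]
        topological_group_open_not_meagre[OF tg T False] by blast
  qed
  have analytic: "\<exists>A. analytic_in T A \<and> meagre_in D ((S - A) \<union> (A - S))"
    if "\<not> meagre_in T (carrier G)" "analytic_in T (carrier G)" "baire_property_in D S" for S
    using baire_property_locally_comeagre_analytic[OF T met]
      topological_group_open_not_meagre[OF tg T that(1)] that(2,3) ts
    unfolding D_def by simp
  show ?thesis
    using base_baire analytic
      istopology_locally_comeagre_sets[of T]
      locally_comeagre_l_coset[OF tg] openin_imp_locally_comeagre[of T]
      locally_comeagre_baire_property[OF T] baire_property_in_Diff_interior_of[of T]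
      baire_property_in_interior_of_Int[of T]
      kemperman_locally_comeagre[OF tg T assms(3,4,5)] ts
    unfolding D_def \<D>_def
    by (intro conjI) (auto)
qed

end
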